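(* Let $U\subseteq V\subseteq R^d$ be $R$-submodules and let $\prec$ be a fixed monomial order on $R^d$. Then $V$ has a unique reduced Gröbner basis relative to $U$.
   Context: $\Bbbk$ is a field, $R=\Bbbk[X_1,\dots,X_n]$, and $R^d$ is the free module with standard basis $\mathbf e_1,\dots,\mathbf e_d$. A module monomial is an element $X^\alpha\mathbf e_i$ with $\alpha\in\mathbb N^n$, $1\le i\le d$; the set of all of them is $\mathrm{Mon}(R^d)$, a $\Bbbk$-basis of $R^d$. The support of $\mathbf f\in R^d$ is the set of module monomials occurring in $\mathbf f$ with non-zero coefficient. A monomial order on $R^d$ is a well-order on $\mathrm{Mon}(R^d)$ compatible with multiplication by monomials of $R$. For $\mathbf f\neq 0$, $\mathrm{lm}(\mathbf f)$ denotes the largest monomial in the support and $\mathrm{lc}(\mathbf f)$ its coefficient. For a submodule $U\subseteq R^d$, $\mathrm{lm}(U)$ is the $\Bbbk$-span of $\{\mathrm{lm}(\mathbf f)\mid 0\ne\mathbf f\in U\}$ (a monomial submodule). For a set $H$ of non-zero elements, $\mathrm{lm}(H)=\{\mathrm{lm}(\mathbf h)\mid\mathbf h\in H\}$ and $\langle\cdot\rangle$ denotes the generated $R$-submodule. Relative Gröbner bases: let $U\subseteq V\subseteq R^d$ be submodules. (1) A finite subset $H\subseteq V\setminus U$ whose elements are supported on $\mathrm{Mon}(R^d)\setminus\mathrm{lm}(U)$ is a Gröbner basis of $V$ relative to $U$ if $\langle\mathrm{lm}(H)\rangle+\mathrm{lm}(U)=\mathrm{lm}(V)$. (2) It is minimal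 if there are no divisibility relations among the leading monomials of (distinct) elements of $H$. (3) A minimal relative Gröbner basis $H$ is reduced if for all $\mathbf h\in H$, $\mathrm{lc}(\mathbf h)=1$ and $\mathbf h-\mathrm{lm}(\mathbf h)$ is supported on $\mathrm{Mon}(R^d)\setminus\mathrm{lm}(V)$. *)

theory Defs
  imports "HOL-Library.Poly_Mapping" "HOL-Library.Set_Algebras"
    "HOL-Analysis.Finite_Cartesian_Product"
begin

text \<open>
  The finite type \<open>'n\<close> indexes the variables and the finite type \<open>'d\<close> the standard basis of the
  free module. The product on \<open>('n, 'k) mpoly\<close> is the convolution product of
  \<^theory>\<open>HOL-Library.Poly_Mapping\<close>, so this is the polynomial ring.
\<close>

type_synonym ('n, 'k) mpoly = "('n \<Rightarrow>\<^sub>0 nat) \<Rightarrow>\<^sub>0 'k"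
type_synonym ('n, 'd, 'k) fmod = "('n, 'k) mpoly ^ 'd"

interpretation fmod: module "(*s) :: 'a::comm_ring_1 \<Rightarrow> 'a ^ 'd \<Rightarrow> 'a ^ 'd"
  by unfold_locales (simp_all add: vec_eq_iff algebra_simps)

definition kscale :: "'k::field \<Rightarrow> ('n, 'd::finite, 'k) fmod \<Rightarrow> ('n, 'd, 'k) fmod"
  where "kscale c f = Poly_Mapping.single 0 c *s f"

interpretation kspace: vector_space "kscale :: 'k::field \<Rightarrow> ('n, 'd::finite, 'k) fmod \<Rightarrow> ('n, 'd, 'k) fmod"
  by unfold_locales
    (simp_all add: kscale_def vec_eq_iff algebra_simps mult_single single_add single_one
      flip: mult.assoc)

definition X_pow :: "('n \<Rightarrow>\<^sub>0 nat) \<Rightarrow> ('n, 'k::field) mpoly"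
  where "X_pow \<alpha> = Poly_Mapping.single \<alpha> 1"

definition mmon :: "('n \<Rightarrow>\<^sub>0 nat) \<Rightarrow> 'd::finite \<Rightarrow> ('n, 'd, 'k::field) fmod"
  where "mmon \<alpha> i = X_pow \<alpha> *s axis i 1"

definition Mon :: "('n, 'd::finite, 'k::field) fmod set"
  where "Mon = {mmon \<alpha> i | \<alpha> i. True}"

definition mcoeff :: "('n, 'd::finite, 'k::field) fmod \<Rightarrow> ('n, 'd, 'k) fmod \<Rightarrow> 'k"
  where "mcoeff f m = (THE c. \<exists>\<alpha> i. m = mmon \<alpha> i \<and> c = Poly_Mapping.lookup (f $ i) \<alpha>)"

lemma mmon_eq_iff:
  "(mmon \<alpha> i :: ('n, 'd::finite, 'k::field) fmod) = mmon \<beta> j \<longleftrightarrow> \<alpha> = \<beta> \<and> i = j"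
proof
  assume eq: "(mmon \<alpha> i :: ('n, 'd, 'k) fmod) = mmon \<beta> j"
  have "Poly_Mapping.lookup ((mmon \<beta> j :: ('n, 'd, 'k) fmod) $ i) \<alpha> = 1"
    unfolding eq[symmetric] by (simp add: mmon_def X_pow_def axis_def)
  then show "\<alpha> = \<beta> \<and> i = j"
    by (auto simp: mmon_def X_pow_def axis_def lookup_single when_def split: if_splits)
qed auto

lemma mcoeff_mmon: "mcoeff f (mmon \<alpha> i) = Poly_Mapping.lookup (f $ i) \<alpha>"
  by (simp add: mcoeff_def mmon_eq_iff)

definition msupp :: "('n, 'd::finite, 'k::field) fmod \<Rightarrow> ('n, 'd, 'k) fmod set"
  where "msupp f = {m \<in> Mon. mcoeff f m \<noteq> 0}"

definition mdvd :: "('n, 'd::finite, 'k::field) fmod \<Rightarrow> ('n, 'd, 'k) fmod \<Rightarrow> bool"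
  where "mdvd u v \<longleftrightarrow> (\<exists>\<gamma>. v = X_pow \<gamma> *s u)"

text \<open>An order is the set of pairs \<open>(u, v)\<close> with \<open>u\<close> smaller than or equal to \<open>v\<close>.\<close>

definition monomial_order :: "('n, 'd::finite, 'k::field) fmod rel \<Rightarrow> bool"
  where "monomial_order r \<longleftrightarrow>
    well_order_on Mon r \<and> (\<forall>\<gamma> u v. (u, v) \<in> r \<longrightarrow> (X_pow \<gamma> *s u, X_pow \<gamma> *s v) \<in> r)"

text \<open>\<open>lm\<close> and \<open>lc\<close> are only meaningful for non-zero arguments.\<close>

definition lm :: "('n, 'd::finite, 'k::field) fmod rel \<Rightarrow> ('n, 'd, 'k) fmod \<Rightarrow> ('n, 'd, 'k) fmod"
  where "lm r f = (THE m. m \<in> msupp f \<and> (\<forall>u\<in>msupp f. (u, m) \<in> r))"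

definition lc :: "('n, 'd::finite, 'k::field) fmod rel \<Rightarrow> ('n, 'd, 'k) fmod \<Rightarrow> 'k"
  where "lc r f = mcoeff f (lm r f)"

definition lm_module ::
    "('n, 'd::finite, 'k::field) fmod rel \<Rightarrow> ('n, 'd, 'k) fmod set \<Rightarrow> ('n, 'd, 'k) fmod set"
  where "lm_module r U = kspace.span {lm r f | f. f \<in> U \<and> f \<noteq> 0}"

definition relative_GB ::
    "('n, 'd::finite, 'k::field) fmod rel \<Rightarrow> ('n, 'd, 'k) fmod set \<Rightarrow> ('n, 'd, 'k) fmod set \<Rightarrow>
     ('n, 'd, 'k) fmod set \<Rightarrow> bool"
  where "relative_GB r U V H \<longleftrightarrow>
    finite H \<and> H \<subseteq> V - U \<and> (\<forall>h\<in>H. msupp h \<subseteq> Mon - lm_module r U) \<and>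
    fmod.span (lm r ` H) + lm_module r U = lm_module r V"

definition minimal_relative_GB ::
    "('n, 'd::finite, 'k::field) fmod rel \<Rightarrow> ('n, 'd, 'k) fmod set \<Rightarrow> ('n, 'd, 'k) fmod set \<Rightarrow>
     ('n, 'd, 'k) fmod set \<Rightarrow> bool"
  where "minimal_relative_GB r U V H \<longleftrightarrow>
    relative_GB r U V H \<and> (\<forall>g\<in>H. \<forall>h\<in>H. g \<noteq> h \<longrightarrow> \<not> mdvd (lm r g) (lm r h))"

definition reduced_relative_GB ::
    "('n, 'd::finite, 'k::field) fmod rel \<Rightarrow> ('n, 'd, 'k) fmod set \<Rightarrow> ('n, 'd, 'k) fmod set \<Rightarrow>
     ('n, 'd, 'k) fmod set \<Rightarrow> bool"
  where "reduced_relative_GB r U V H \<longleftrightarrow>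
    minimal_relative_GB r U V H \<and>
    (\<forall>h\<in>H. lc r h = 1 \<and> msupp (h - lm r h) \<subseteq> Mon - lm_module r V)"

end

theory Submission
  imports Defs
begin

text \<open>
  Write \<open>L(U)\<close> for the set of leading monomials of a submodule \<open>U\<close>. Module monomials are linearly
  independent over the field, so a monomial subspace is determined by the monomials in it:
  \<open>lm(U)\<close> is the space of all elements supported on \<open>L(U)\<close>, and
  \<open>\<langle>lm(H)\<rangle> + lm(U) = lm(V)\<close> says that every monomial of \<open>L(V)\<close> outside \<open>L(U)\<close> is divisible by the
  leading monomial of some element of \<open>H\<close> (\<open>span_lm_plus_lm_module_iff\<close>). This reduces the
  theorem to the combinatorics of the two sets \<open>L(U) \<subseteq> L(V)\<close>, both closed under multiplication by
  monomials.

  Let \<open>M\<close> consist of the divisibility-minimal elements of \<open>L(V)\<close> that are not in \<open>L(U)\<close>. By Dickson's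
  lemma \<open>M\<close> is finite, and since \<open>L(U)\<close> is closed under multiples, each element of \<open>L(V)\<close> outside
  \<open>L(U)\<close> has a divisor in \<open>M\<close>. The leading monomials of a reduced basis avoid \<open>L(U)\<close>, generate
  \<open>L(V)\<close> up to \<open>L(U)\<close> and form an antichain, so they have to be exactly the elements of \<open>M\<close>.

  It remains to see that for each \<open>m \<in> M\<close> there is exactly one \<open>h \<in> V\<close> with leading coefficient
  \<open>1\<close>, leading monomial \<open>m\<close> and \<open>h - m\<close> supported outside \<open>L(V)\<close>. Two such elements differ by an
  element of \<open>V\<close> that is supported outside \<open>L(V)\<close>, and such an element is \<open>0\<close>. For existence, every
  element is congruent modulo \<open>V\<close> to one that is supported outside \<open>L(V)\<close>, its normal form
  (\<open>normal_form_exists\<close>); if \<open>g\<close> is the normal form of \<open>m\<close>, then \<open>h = m - g\<close> lies in \<open>V\<close>. Its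
  leading monomial lies in \<open>L(V)\<close> and occurs in \<open>m - g\<close>, and the only such monomial is \<open>m\<close>.
\<close>

section \<open>Coefficients and supports\<close>

lemma lookup_single_mult:
  fixes p :: "'a::cancel_comm_monoid_add \<Rightarrow>\<^sub>0 'b::comm_semiring_1"
  shows "Poly_Mapping.lookup (Poly_Mapping.single \<gamma> c * p) (\<gamma> + \<alpha>) = c * Poly_Mapping.lookup p \<alpha>"
  by (simp add: lookup_mult lookup_single when_mult)

lemma lookup_X_pow_mult:
  "Poly_Mapping.lookup (X_pow \<gamma> * p) (\<gamma> + \<alpha>) = Poly_Mapping.lookup p \<alpha>"
  by (simp add: X_pow_def lookup_single_mult)

lemma mmon_nth: "mmon \<alpha> i $ j = (Poly_Mapping.single \<alpha> 1 when i = j)"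
  by (simp add: mmon_def X_pow_def axis_def when_def)

lemma MonE:
  assumes "m \<in> Mon" obtains \<alpha> i where "m = mmon \<alpha> i"
  using assms by (auto simp: Mon_def)

lemma mmon_in_Mon [simp]: "mmon \<alpha> i \<in> Mon"
  by (auto simp: Mon_def)

lemma X_pow_mmon: "X_pow \<gamma> *s mmon \<alpha> i = mmon (\<gamma> + \<alpha>) i"
  by (simp add: mmon_def X_pow_def mult_single)

lemma X_pow_mult: "X_pow (\<gamma> + \<delta>) = X_pow \<gamma> * X_pow \<delta>"
  by (simp add: X_pow_def mult_single)

lemma X_pow_0: "X_pow 0 = 1"
  by (simp add: X_pow_def)

lemma X_pow_Mon: "m \<in> Mon \<Longrightarrow> X_pow \<gamma> *s m \<in> Mon"
  by (elim MonE) (simp add: X_pow_mmon)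

lemma mcoeff_0: "m \<in> Mon \<Longrightarrow> mcoeff 0 m = 0"
  by (elim MonE) (simp add: mcoeff_mmon)

lemma mcoeff_add: "m \<in> Mon \<Longrightarrow> mcoeff (f + g) m = mcoeff f m + mcoeff g m"
  by (elim MonE) (simp add: mcoeff_mmon lookup_add)

lemma mcoeff_diff: "m \<in> Mon \<Longrightarrow> mcoeff (f - g) m = mcoeff f m - mcoeff g m"
  by (elim MonE) (simp add: mcoeff_mmon lookup_minus)

lemma mcoeff_kscale: "m \<in> Mon \<Longrightarrow> mcoeff (kscale c f) m = c * mcoeff f m"
  using lookup_single_mult[of 0 c] by (elim MonE) (simp add: mcoeff_mmon kscale_def)

lemma mcoeff_sum: "m \<in> Mon \<Longrightarrow> mcoeff (\<Sum>x\<in>A. f x) m = (\<Sum>x\<in>A. mcoeff (f x) m)"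
  by (induction A rule: infinite_finite_induct) (simp_all add: mcoeff_0 mcoeff_add)

lemma mcoeff_Mon:
  "u \<in> Mon \<Longrightarrow> m \<in> Mon \<Longrightarrow> mcoeff u m = (if u = m then 1 else 0)"
  by (elim MonE) (auto simp: mcoeff_mmon mmon_nth mmon_eq_iff lookup_single when_def)

lemma mcoeff_X_pow:
  "m \<in> Mon \<Longrightarrow> mcoeff (X_pow \<gamma> *s f) (X_pow \<gamma> *s m) = mcoeff f m"
  by (elim MonE) (simp add: X_pow_mmon mcoeff_mmon lookup_X_pow_mult)

lemma mcoeff_eqI:
  fixes f g :: "('n, 'd::finite, 'k::field) fmod"
  assumes "\<And>m. m \<in> Mon \<Longrightarrow> mcoeff f m = mcoeff g m"
  shows "f = g"
proof -
  have "Poly_Mapping.lookup (f $ i) \<alpha> = Poly_Mapping.lookup (g $ i) \<alpha>" for i \<alpha>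
    using assms[of "mmon \<alpha> i"] by (simp add: mcoeff_mmon)
  then show ?thesis
    by (simp add: vec_eq_iff poly_mapping_eq_iff fun_eq_iff)
qed

lemma msupp_subset_Mon: "msupp f \<subseteq> Mon"
  by (auto simp: msupp_def)

lemma msupp_Mon: "m \<in> Mon \<Longrightarrow> msupp m = {m}"
  by (auto simp: msupp_def mcoeff_Mon split: if_splits)

lemma msupp_0: "msupp 0 = {}"
  by (auto simp: msupp_def mcoeff_0)

lemma msupp_empty_iff: "msupp f = {} \<longleftrightarrow> f = 0"
  using mcoeff_eqI[of f 0] by (auto simp: msupp_0) (auto simp: msupp_def mcoeff_0)

lemma msupp_add: "msupp (f + g) \<subseteq> msupp f \<union> msupp g"
  by (auto simp: msupp_def mcoeff_add)

lemma msupp_diff: "msupp (f - g) \<subseteq> msupp f \<union> msupp g"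
  by (auto simp: msupp_def mcoeff_diff)

lemma msupp_kscale: "msupp (kscale c f) \<subseteq> msupp f"
  by (auto simp: msupp_def mcoeff_kscale)

lemma finite_msupp: "finite (msupp f)"
proof (rule finite_subset)
  show "msupp f \<subseteq> (\<Union>i. (\<lambda>\<alpha>. mmon \<alpha> i) ` Poly_Mapping.keys (f $ i))"
    by (auto simp: msupp_def mcoeff_mmon in_keys_iff mmon_eq_iff image_iff elim!: MonE)
qed simp

lemma msupp_smult: "msupp (p *s f) \<subseteq> {X_pow \<gamma> *s m | \<gamma> m. m \<in> msupp f}"
proof
  fix m assume m: "m \<in> msupp (p *s f)"
  then obtain \<alpha> i where [simp]: "m = mmon \<alpha> i"
    by (auto simp: msupp_def elim: MonE)
  have "\<alpha> \<in> Poly_Mapping.keys (p * (f $ i))"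
    using m by (simp add: msupp_def mcoeff_mmon in_keys_iff)
  then obtain \<gamma> \<beta> where "\<alpha> = \<gamma> + \<beta>" "\<beta> \<in> Poly_Mapping.keys (f $ i)"
    using keys_mult by blast
  then have "m = X_pow \<gamma> *s mmon \<beta> i" "mmon \<beta> i \<in> msupp f"
    by (simp_all add: X_pow_mmon msupp_def mcoeff_mmon in_keys_iff)
  then show "m \<in> {X_pow \<gamma> *s m | \<gamma> m. m \<in> msupp f}"
    by blast
qed

lemma msupp_X_pow: "msupp (X_pow \<gamma> *s f) = (\<lambda>m. X_pow \<gamma> *s m) ` msupp f"
proof
  show "(\<lambda>m. X_pow \<gamma> *s m) ` msupp f \<subseteq> msupp (X_pow \<gamma> *s f)"
    by (auto simp: msupp_def mcoeff_X_pow X_pow_Mon)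
  show "msupp (X_pow \<gamma> *s f) \<subseteq> (\<lambda>m. X_pow \<gamma> *s m) ` msupp f"
  proof
    fix m assume m: "m \<in> msupp (X_pow \<gamma> *s f)"
    then obtain \<alpha> i where [simp]: "m = mmon \<alpha> i"
      by (auto simp: msupp_def elim: MonE)
    have "\<alpha> \<in> Poly_Mapping.keys (X_pow \<gamma> * (f $ i))"
      using m by (simp add: msupp_def mcoeff_mmon in_keys_iff)
    then obtain \<beta> where "\<alpha> = \<gamma> + \<beta>" "\<beta> \<in> Poly_Mapping.keys (f $ i)"
      using keys_mult[of "X_pow \<gamma>" "f $ i"] by (auto simp: X_pow_def)
    then show "m \<in> (\<lambda>m. X_pow \<gamma> *s m) ` msupp f"
      by (auto simp: X_pow_mmon msupp_def mcoeff_mmon in_keys_iff intro!: image_eqI[of _ _ "mmon \<beta> i"])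
  qed
qed

section \<open>Monomial subspaces and submodules\<close>

lemma kspace_subspace_if_fmod: "fmod.subspace U \<Longrightarrow> kspace.subspace U"
  by (auto simp: fmod.subspace_def kspace.subspace_def kscale_def)

text \<open>
  Each element is the sum of its terms, and an element supported on \<open>A\<close> stays so under linear
  combinations. Every statement about monomial subspaces below becomes one about sets of monomials
  by means of this description.
\<close>

lemma kspace_span_Mon:
  fixes A :: "('n, 'd::finite, 'k::field) fmod set"
  assumes "A \<subseteq> Mon"
  shows "kspace.span A = {f. msupp f \<subseteq> A}"
proof
  have "kspace.subspace {f. msupp f \<subseteq> A}"
    unfolding kspace.subspace_def mem_Collect_eq
    by (auto simp: msupp_0 dest!: subsetD[OF msupp_add] subsetD[OF msupp_kscale])
  then show "kspace.span A \<subseteq> {f. msupp f \<subseteq> A}"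
    using assms by (intro kspace.span_minimal) (auto simp: msupp_Mon)
  show "{f. msupp f \<subseteq> A} \<subseteq> kspace.span A"
  proof safe
    fix f :: "('n, 'd, 'k) fmod" assume sub: "msupp f \<subseteq> A"
    have "f = (\<Sum>m\<in>msupp f. kscale (mcoeff f m) m)"
    proof (rule mcoeff_eqI)
      fix m :: "('n, 'd, 'k) fmod" assume m: "m \<in> Mon"
      have "mcoeff (\<Sum>u\<in>msupp f. kscale (mcoeff f u) u) m
        = (\<Sum>u\<in>msupp f. if u = m then mcoeff f u else 0)"
        unfolding mcoeff_sum[OF m] using msupp_subset_Mon[of f] m
        by (intro sum.cong) (auto simp: mcoeff_kscale mcoeff_Mon)
      also have "\<dots> = mcoeff f m"
        using m by (simp add: finite_msupp) (simp add: msupp_def)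
      finally show "mcoeff f m = mcoeff (\<Sum>m\<in>msupp f. kscale (mcoeff f m) m) m" ..
    qed
    moreover have "(\<Sum>m\<in>msupp f. kscale (mcoeff f m) m) \<in> kspace.span A"
      using sub by (intro kspace.span_sum kspace.span_scale kspace.span_base) auto
    ultimately show "f \<in> kspace.span A"
      by simp
  qed
qed

lemma kspace_span_Mon_eq_iff:
  fixes A B :: "('n, 'd::finite, 'k::field) fmod set"
  assumes "A \<subseteq> Mon" "B \<subseteq> Mon"
  shows "kspace.span A = kspace.span B \<longleftrightarrow> A = B"
proof -
  have "A = Mon \<inter> kspace.span A" if "A \<subseteq> Mon" for A :: "('n, 'd, 'k) fmod set"
    using that by (auto simp: kspace_span_Mon msupp_Mon)
  then show ?thesis
    using assms by metis
qed

definition mmultiples :: "('n, 'd::finite, 'k::field) fmod set \<Rightarrow> ('n, 'd, 'k) fmod set"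
  where "mmultiples B = {m. \<exists>b\<in>B. mdvd b m}"

lemma mdvd_refl: "mdvd m m"
  by (auto simp: mdvd_def X_pow_0 intro: exI[of _ 0])

lemma mdvd_trans: "mdvd a b \<Longrightarrow> mdvd b c \<Longrightarrow> mdvd a c"
proof -
  assume "mdvd a b" "mdvd b c"
  then obtain \<gamma> \<delta> where "b = X_pow \<gamma> *s a" "c = X_pow \<delta> *s b"
    by (auto simp: mdvd_def)
  then have "c = X_pow (\<delta> + \<gamma>) *s a"
    by (simp add: X_pow_mult)
  then show ?thesis
    by (auto simp: mdvd_def)
qed

lemma mmultiples_subset_Mon: "B \<subseteq> Mon \<Longrightarrow> mmultiples B \<subseteq> Mon"
  by (auto simp: mmultiples_def mdvd_def X_pow_Mon)

text \<open>
  Multiplication by a polynomial only replaces the monomials of a support by multiples of them.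
\<close>

lemma fmod_span_Mon:
  assumes "B \<subseteq> Mon"
  shows "fmod.span B = kspace.span (mmultiples B)"
proof
  have "fmod.subspace {f. msupp f \<subseteq> mmultiples B}"
    unfolding fmod.subspace_def
  proof safe
    fix c f m assume f: "msupp f \<subseteq> mmultiples B" and "m \<in> msupp (c *s f)"
    then obtain \<gamma> u where m: "m = X_pow \<gamma> *s u" and "u \<in> msupp f"
      using msupp_smult by blast
    then obtain b where "b \<in> B" "mdvd b u"
      using f by (auto simp: mmultiples_def)
    moreover have "mdvd u m"
      using m by (auto simp: mdvd_def)
    ultimately show "m \<in> mmultiples B"
      by (auto simp: mmultiples_def intro: mdvd_trans)
  next
    fix f g m assume "msupp f \<subseteq> mmultiples B" "msupp g \<subseteq> mmultiples B" "m \<in> msupp (f + g)"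
    then show "m \<in> mmultiples B"
      using msupp_add by blast
  qed (simp add: msupp_0)
  moreover have "msupp b \<subseteq> mmultiples B" if "b \<in> B" for b
  proof -
    have "msupp b = {b}"
      using that assms by (intro msupp_Mon) auto
    then show ?thesis
      using that mdvd_refl by (auto simp: mmultiples_def)
  qed
  ultimately show "fmod.span B \<subseteq> kspace.span (mmultiples B)"
    unfolding kspace_span_Mon[OF mmultiples_subset_Mon[OF assms]]
    by (intro fmod.span_minimal) auto
  have "mmultiples B \<subseteq> fmod.span B"
    unfolding mmultiples_def mdvd_def using fmod.span_scale fmod.span_base by blast
  then show "kspace.span (mmultiples B) \<subseteq> fmod.span B"
    by (intro kspace.span_minimal kspace_subspace_if_fmod fmod.subspace_span)
qed

section \<open>Leading monomials\<close>

definition lead_mons ::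
    "('n, 'd::finite, 'k::field) fmod rel \<Rightarrow> ('n, 'd, 'k) fmod set \<Rightarrow> ('n, 'd, 'k) fmod set"
  where "lead_mons r U = lm r ` (U - {0})"

lemma lead_mons_mono: "U \<subseteq> V \<Longrightarrow> lead_mons r U \<subseteq> lead_mons r V"
  by (auto simp: lead_mons_def)

lemma lm_module_eq_span: "lm_module r U = kspace.span (lead_mons r U)"
  unfolding lm_module_def lead_mons_def by (rule arg_cong[where f = kspace.span]) auto

context
  fixes r :: "('n, 'd::finite, 'k::field) fmod rel"
  assumes ord: "monomial_order r"
begin

lemma order_linear: "linear_order_on Mon r"
  using ord by (auto simp: monomial_order_def well_order_on_def)

lemma order_wf: "wf (r - Id)"
  using ord by (auto simp: monomial_order_def well_order_on_def)

lemma order_X_pow: "(a, b) \<in> r \<Longrightarrow> (X_pow \<gamma> *s a, X_pow \<gamma> *s b) \<in> r"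
  using ord by (auto simp: monomial_order_def)

lemma order_refl: "m \<in> Mon \<Longrightarrow> (m, m) \<in> r"
  using order_linear by (auto simp: order_on_defs dest: refl_onD)

lemma order_trans: "(a, b) \<in> r \<Longrightarrow> (b, c) \<in> r \<Longrightarrow> (a, c) \<in> r"
  using order_linear by (auto simp: order_on_defs dest: transD)

lemma order_antisym: "(a, b) \<in> r \<Longrightarrow> (b, a) \<in> r \<Longrightarrow> a = b"
  using order_linear by (auto simp: order_on_defs dest: antisymD)

lemma order_total: "a \<in> Mon \<Longrightarrow> b \<in> Mon \<Longrightarrow> (a, b) \<in> r \<or> (b, a) \<in> r"
  using order_linear order_refl by (cases "a = b") (auto simp: order_on_defs total_on_def)

lemma finite_Mon_greatest:
  assumes "finite A" "A \<noteq> {}" "A \<subseteq> Mon"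
  shows "\<exists>m\<in>A. \<forall>u\<in>A. (u, m) \<in> r"
  using assms
proof (induction rule: finite_ne_induct)
  case (singleton x)
  then show ?case by (simp add: order_refl)
next
  case (insert x F)
  then obtain m where m: "m \<in> F" "\<forall>u\<in>F. (u, m) \<in> r"
    by auto
  have "x \<in> Mon" "m \<in> Mon"
    using insert.prems \<open>m \<in> F\<close> by auto
  then consider "(x, m) \<in> r" | "(m, x) \<in> r" "(x, x) \<in> r"
    using order_total[of x m] order_refl[of x] by blast
  then show ?case
  proof cases
    case 1
    then show ?thesis
      using m by blast
  next
    case 2
    then show ?thesis
      using m order_trans by blast
  qed
qed

lemma lm_eqI: "m \<in> msupp f \<Longrightarrow> (\<And>u. u \<in> msupp f \<Longrightarrow> (u, m) \<in> r) \<Longrightarrow> lm r f = m"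
  unfolding lm_def by (intro the_equality) (auto intro: order_antisym)

lemma
  assumes "f \<noteq> 0"
  shows lm_in_msupp: "lm r f \<in> msupp f"
    and lm_greatest: "u \<in> msupp f \<Longrightarrow> (u, lm r f) \<in> r"
proof -
  obtain m where "m \<in> msupp f" "\<forall>u\<in>msupp f. (u, m) \<in> r"
    using finite_Mon_greatest[OF finite_msupp _ msupp_subset_Mon] assms
    by (auto simp: msupp_empty_iff)
  with lm_eqI[of m f] show "lm r f \<in> msupp f" "u \<in> msupp f \<Longrightarrow> (u, lm r f) \<in> r"
    by auto
qed

lemma lm_in_Mon: "f \<noteq> 0 \<Longrightarrow> lm r f \<in> Mon"
  using lm_in_msupp msupp_subset_Mon by blast

text \<open>
  Compatibility of the order with multiplication enters the argument only here; it makes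
  \<open>lead_mons r U\<close> closed under multiples.
\<close>

lemma lm_X_pow: "f \<noteq> 0 \<Longrightarrow> lm r (X_pow \<gamma> *s f) = X_pow \<gamma> *s lm r f"
  using lm_in_msupp lm_greatest order_X_pow by (intro lm_eqI) (auto simp: msupp_X_pow)

lemma lead_mons_subset_Mon: "lead_mons r U \<subseteq> Mon"
  using lm_in_Mon by (auto simp: lead_mons_def)

lemma Mon_diff_lm_module: "Mon - lm_module r U = Mon - lead_mons r U"
proof -
  have "m \<in> lm_module r U \<longleftrightarrow> m \<in> lead_mons r U" if "m \<in> Mon" for m
    using that by (simp add: lm_module_eq_span kspace_span_Mon[OF lead_mons_subset_Mon] msupp_Mon)
  then show ?thesis
    by blast
qed

lemma lead_mons_mdvd:
  assumes "fmod.subspace U" "u \<in> lead_mons r U" "mdvd u v"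
  shows "v \<in> lead_mons r U"
proof -
  obtain f \<gamma> where f: "f \<in> U" "f \<noteq> 0" and v: "v = X_pow \<gamma> *s lm r f"
    using assms(2,3) by (auto simp: lead_mons_def mdvd_def)
  have "X_pow \<gamma> *s f \<noteq> 0"
    using f(2) by (simp add: msupp_empty_iff[symmetric] msupp_X_pow)
  then show ?thesis
    using fmod.subspace_scale[OF assms(1) f(1)] lm_X_pow[OF f(2)] v
    by (auto simp: lead_mons_def intro!: image_eqI[of _ _ "X_pow \<gamma> *s f"])
qed

lemma zero_if_msupp_disjoint_lead_mons:
  assumes "f \<in> V" "msupp f \<inter> lead_mons r V = {}"
  shows "f = 0"
proof (rule ccontr)
  assume "f \<noteq> 0"
  then have "lm r f \<in> msupp f \<inter> lead_mons r V"
    using assms(1) lm_in_msupp by (auto simp: lead_mons_def)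
  with assms(2) show False
    by blast
qed

text \<open>
  Both sides of the defining equation of a relative Groebner basis are spanned by monomials over the
  field, so the equation can be tested on the monomials they contain.
\<close>

lemma span_lm_plus_lm_module_iff:
  assumes "0 \<notin> H"
  shows "fmod.span (lm r ` H) + lm_module r U = lm_module r V \<longleftrightarrow>
    mmultiples (lm r ` H) \<union> lead_mons r U = lead_mons r V"
proof -
  have H: "lm r ` H \<subseteq> Mon"
  proof (rule image_subsetI)
    fix h assume "h \<in> H"
    then show "lm r h \<in> Mon"
      using assms by (intro lm_in_Mon) auto
  qed
  have plus: "A + B = {x + y | x y. x \<in> A \<and> y \<in> B}" for A B :: "('n, 'd, 'k) fmod set"
    by (auto simp: set_plus_def)
  have "fmod.span (lm r ` H) + lm_module r U = kspace.span (mmultiples (lm r ` H) \<union> lead_mons r U)"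
    unfolding fmod_span_Mon[OF H] lm_module_eq_span kspace.span_Un plus ..
  moreover have "mmultiples (lm r ` H) \<union> lead_mons r U \<subseteq> Mon"
    using mmultiples_subset_Mon[OF H] lead_mons_subset_Mon by auto
  ultimately show ?thesis
    using kspace_span_Mon_eq_iff[OF _ lead_mons_subset_Mon] by (simp add: lm_module_eq_span)
qed

section \<open>Normal forms\<close>

text \<open>
  The elements that have a normal form are a subspace, so it is enough to treat a monomial \<open>m\<close>, by
  well-founded induction along the order. If \<open>m\<close> is not a leading monomial of \<open>V\<close>, it is its own
  normal form. Otherwise \<open>m\<close> is the leading monomial of a monic element of \<open>V\<close>, and \<open>m\<close> minus that
  element is a combination of smaller monomials.
\<close>

lemma normal_form_exists:
  assumes V: "fmod.subspace V"
  shows "\<exists>g. f - g \<in> V \<and> msupp g \<inter> lead_mons r V = {}"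
proof -
  note kV = kspace_subspace_if_fmod[OF V]
  define N where "N = {f. \<exists>g. f - g \<in> V \<and> msupp g \<inter> lead_mons r V = {}}"
  have N: "kspace.subspace N"
    unfolding kspace.subspace_def
  proof (intro conjI ballI allI)
    show "0 \<in> N"
      using kspace.subspace_0[OF kV] by (auto simp: N_def msupp_0 intro!: exI[of _ 0])
  next
    fix x y assume "x \<in> N" "y \<in> N"
    then obtain a b where "x - a \<in> V" "y - b \<in> V" "msupp a \<inter> lead_mons r V = {}" "msupp b \<inter> lead_mons r V = {}"
      by (auto simp: N_def)
    moreover from this have "(x - a) + (y - b) \<in> V"
      using kspace.subspace_add[OF kV] by blast
    moreover have "(x - a) + (y - b) = (x + y) - (a + b)"
      by simp
    ultimately show "x + y \<in> N"
      unfolding N_def using msupp_add[of a b] by (auto intro!: exI[of _ "a + b"])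
  next
    fix c x assume "x \<in> N"
    then obtain a where "x - a \<in> V" "msupp a \<inter> lead_mons r V = {}"
      by (auto simp: N_def)
    moreover from this have "kscale c (x - a) \<in> V"
      using kspace.subspace_scale[OF kV] by blast
    ultimately show "kscale c x \<in> N"
      unfolding N_def kspace.scale_right_diff_distrib
      using msupp_kscale[of c a] by (auto intro!: exI[of _ "kscale c a"])
  qed
  have "m \<in> N" if "m \<in> Mon" for m
    using order_wf that
  proof (induction m rule: wf_induct_rule)
    case (less m)
    show ?case
    proof (cases "m \<in> lead_mons r V")
      case False
      then show ?thesis
        using kspace.subspace_0[OF kV] less.prems
        by (auto simp: N_def msupp_Mon intro!: exI[of _ m])
    next
      case True
      then obtain f where f: "f \<in> V" "f \<noteq> 0" and m: "m = lm r f"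
        by (auto simp: lead_mons_def)
      define c where "c = mcoeff f m"
      have c: "c \<noteq> 0"
        using lm_in_msupp[OF f(2)] by (simp add: c_def m msupp_def)
      define t where "t = m - kscale (inverse c) f"
      \<comment> \<open>The terms at \<open>m\<close> cancel in \<open>t\<close>, which leaves only monomials below \<open>m\<close>.\<close>
      have "msupp t \<subseteq> N"
      proof
        fix u assume "u \<in> msupp t"
        then have u: "u \<in> Mon" and ut: "mcoeff t u \<noteq> 0"
          by (auto simp: msupp_def)
        have "mcoeff t u = (if m = u then 1 else 0) - inverse c * mcoeff f u"
          using u less.prems by (simp add: t_def mcoeff_diff mcoeff_kscale mcoeff_Mon)
        with ut c have "u \<noteq> m" "u \<in> msupp f"
          using u by (auto simp: c_def msupp_def split: if_splits)
        then show "u \<in> N"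
          using lm_greatest[OF f(2)] m u by (intro less.IH) auto
      qed
      then have "t \<in> N"
        using kspace_span_Mon[OF msupp_subset_Mon[of t]] kspace.span_minimal[OF _ N] by blast
      moreover have "kscale (inverse c) f \<in> N"
        using kspace.subspace_scale[OF kV f(1)]
        by (auto simp: N_def msupp_0 intro!: exI[of _ 0])
      ultimately show ?thesis
        using kspace.subspace_add[OF N, of t "kscale (inverse c) f"] by (simp add: t_def)
    qed
  qed
  then have "f \<in> N"
    using kspace_span_Mon[of Mon] kspace.span_minimal[OF _ N, of Mon] msupp_subset_Mon[of f] by blast
  then show ?thesis
    by (simp add: N_def)
qed

end

section \<open>Dickson's lemma\<close>

text \<open>
  Choose repeatedly a later index at which the remaining values are smallest.
\<close>

lemma nat_seq_mono_subseq:
  fixes s :: "nat \<Rightarrow> nat"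
  shows "\<exists>\<phi> :: nat \<Rightarrow> nat. strict_mono \<phi> \<and> mono (\<lambda>k. s (\<phi> k))"
proof -
  have least: "\<exists>y>x. \<forall>j>x. s y \<le> s j" for x
    using ex_has_least_nat[of "\<lambda>y. y > x" "Suc x" s] by auto
  have "\<exists>\<phi>. \<forall>n. (\<forall>j\<ge>\<phi> n. s (\<phi> n) \<le> s j) \<and> \<phi> n < \<phi> (Suc n)"
  proof (rule dependent_nat_choice)
    show "\<exists>y. \<forall>j\<ge>y. s y \<le> s j"
      using least[of 0] by (meson less_le_trans)
  next
    fix x n
    show "\<exists>y. (\<forall>j\<ge>y. s y \<le> s j) \<and> x < y"
      using least[of x] by (meson less_le_trans)
  qed
  then obtain \<phi> where \<phi>: "\<And>n j. \<phi> n \<le> j \<Longrightarrow> s (\<phi> n) \<le> s j" "\<And>n. \<phi> n < \<phi> (Suc n)"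
    by blast
  have "strict_mono \<phi>"
    using \<phi>(2) by (simp add: strict_mono_Suc_iff)
  moreover have "mono (\<lambda>k. s (\<phi> k))"
    using \<phi> by (simp add: mono_iff_le_Suc less_imp_le)
  ultimately show ?thesis
    by blast
qed

text \<open>
  Dickson's lemma in the form of a subsequence that is monotone in each coordinate of \<open>S\<close>: pass to a
  subsequence for one coordinate after the other.
\<close>

lemma dickson_subseq:
  fixes s :: "nat \<Rightarrow> 'a \<Rightarrow> nat"
  assumes "finite S"
  shows "\<exists>\<phi> :: nat \<Rightarrow> nat. strict_mono \<phi> \<and> (\<forall>x\<in>S. mono (\<lambda>k. s (\<phi> k) x))"
  using assms
proof (induction S rule: finite_induct)
  case empty
  have "strict_mono (\<lambda>k :: nat. k)"
    by (simp add: strict_mono_def)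
  then show ?case
    by blast
next
  case (insert y S)
  then obtain \<phi> :: "nat \<Rightarrow> nat" where \<phi>: "strict_mono \<phi>" "\<And>x. x \<in> S \<Longrightarrow> mono (\<lambda>k. s (\<phi> k) x)"
    by blast
  obtain \<psi> :: "nat \<Rightarrow> nat" where \<psi>: "strict_mono \<psi>" "mono (\<lambda>k. s (\<phi> (\<psi> k)) y)"
    using nat_seq_mono_subseq[of "\<lambda>k. s (\<phi> k) y"] by blast
  have "mono (\<lambda>k. s (\<phi> (\<psi> k)) x)" if "x \<in> S" for x
    using \<phi>(2)[OF that] \<psi>(1) by (simp add: mono_def strict_mono_less_eq)
  moreover have "strict_mono (\<lambda>k. \<phi> (\<psi> k))"
    using strict_mono_o[OF \<phi>(1) \<psi>(1)] by (simp add: comp_def)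
  ultimately show ?case
    using \<psi>(2) by (intro exI[of _ "\<lambda>k. \<phi> (\<psi> k)"]) simp
qed

definition mdvd_minimal :: "('n, 'd::finite, 'k::field) fmod set \<Rightarrow> ('n, 'd, 'k) fmod set"
  where "mdvd_minimal A = {m \<in> A. \<forall>u\<in>A. mdvd u m \<longrightarrow> u = m}"

lemma mdvd_mmon_if_le:
  assumes "\<And>x. Poly_Mapping.lookup \<alpha> x \<le> Poly_Mapping.lookup \<beta> x"
  shows "mdvd (mmon \<alpha> i) (mmon \<beta> i)"
proof -
  have "\<beta> = (\<beta> - \<alpha>) + \<alpha>"
    using assms by (simp add: poly_mapping_eq_iff fun_eq_iff lookup_add lookup_minus)
  then show ?thesis
    unfolding mdvd_def X_pow_mmon by metis
qed

text \<open>
  Otherwise infinitely many of the monomials would belong to the same basis vector, and two of their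
  exponents would be comparable in all coordinates at once.
\<close>

lemma finite_mdvd_antichain:
  fixes A :: "('n::finite, 'd::finite, 'k::field) fmod set"
  assumes A: "A \<subseteq> Mon" and antichain: "\<And>u v. u \<in> A \<Longrightarrow> v \<in> A \<Longrightarrow> mdvd u v \<Longrightarrow> u = v"
  shows "finite A"
proof -
  define E where "E = (\<lambda>i. {\<alpha>. mmon \<alpha> i \<in> A})"
  have "finite (E i)" for i
  proof (rule ccontr)
    assume "infinite (E i)"
    then obtain s :: "nat \<Rightarrow> 'n \<Rightarrow>\<^sub>0 nat" where s: "inj s" "range s \<subseteq> E i"
      using infinite_countable_subset by blast
    obtain \<phi> :: "nat \<Rightarrow> nat" where \<phi>: "strict_mono \<phi>" "\<And>x. mono (\<lambda>k. Poly_Mapping.lookup (s (\<phi> k)) x)"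
      using dickson_subseq[of UNIV "\<lambda>k. Poly_Mapping.lookup (s k)"] by auto
    have "mdvd (mmon (s (\<phi> 0)) i :: ('n, 'd, 'k) fmod) (mmon (s (\<phi> 1)) i)"
      using \<phi>(2) by (intro mdvd_mmon_if_le) (simp add: mono_def)
    then have "s (\<phi> 0) = s (\<phi> 1)"
      using antichain s(2) unfolding E_def by (metis mem_Collect_eq mmon_eq_iff rangeI subset_iff)
    then show False
      using s(1) \<phi>(1) by (metis injD strict_mono_eq zero_neq_one)
  qed
  moreover have "A \<subseteq> (\<Union>i. (\<lambda>\<alpha>. mmon \<alpha> i) ` E i)"
  proof
    fix m assume m: "m \<in> A"
    then obtain \<alpha> i where "m = mmon \<alpha> i"
      using A MonE by blast
    then show "m \<in> (\<Union>i. (\<lambda>\<alpha>. mmon \<alpha> i) ` E i)"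
      using m by (auto simp: E_def)
  qed
  ultimately show ?thesis
    by (meson finite_UN_I finite_imageI finite_subset finite)
qed

lemma finite_mdvd_minimal:
  fixes A :: "('n::finite, 'd::finite, 'k::field) fmod set"
  shows "A \<subseteq> Mon \<Longrightarrow> finite (mdvd_minimal A)"
  by (rule finite_mdvd_antichain) (auto simp: mdvd_minimal_def)

text \<open>
  A divisor in \<open>A\<close> of least total degree is minimal, because a proper divisor has smaller degree.
\<close>

lemma mdvd_minimal_divisor:
  fixes A :: "('n::finite, 'd::finite, 'k::field) fmod set"
  assumes A: "A \<subseteq> Mon" and m: "m \<in> A"
  shows "\<exists>u\<in>mdvd_minimal A. mdvd u m"
proof -
  define deg where "deg = (\<lambda>\<alpha> :: 'n \<Rightarrow>\<^sub>0 nat. \<Sum>x\<in>UNIV. Poly_Mapping.lookup \<alpha> x)"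
  define P where "P = (\<lambda>\<alpha>. \<exists>i. mmon \<alpha> i \<in> A \<and> mdvd (mmon \<alpha> i) m)"
  obtain \<alpha>0 i0 where "m = mmon \<alpha>0 i0"
    using A m MonE by blast
  then have "P \<alpha>0"
    using m by (auto simp: P_def intro: mdvd_refl)
  then obtain \<alpha> where "P \<alpha>" and least: "\<And>\<beta>. P \<beta> \<Longrightarrow> deg \<alpha> \<le> deg \<beta>"
    using ex_has_least_nat[of P _ deg] by blast
  then obtain i where i: "mmon \<alpha> i \<in> A" "mdvd (mmon \<alpha> i) m"
    by (auto simp: P_def)
  have "u = mmon \<alpha> i" if u: "u \<in> A" "mdvd u (mmon \<alpha> i)" for u
  proof -
    obtain \<beta> j where [simp]: "u = mmon \<beta> j"
      using A u(1) MonE by blast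
    obtain \<gamma> where \<gamma>: "\<alpha> = \<gamma> + \<beta>" "i = j"
      using u(2) by (auto simp: mdvd_def X_pow_mmon mmon_eq_iff)
    have "P \<beta>"
      using u i(2) mdvd_trans by (fastforce simp: P_def)
    then have "deg \<gamma> = 0"
      using least[of \<beta>] \<gamma>(1) by (simp add: deg_def lookup_add sum.distrib)
    then have "\<gamma> = 0"
      by (simp add: deg_def poly_mapping_eq_iff fun_eq_iff)
    then show ?thesis
      using \<gamma> by simp
  qed
  then show ?thesis
    using i by (auto simp: mdvd_minimal_def)
qed

section \<open>The reduced relative basis\<close>

definition reduced_set ::
    "('n, 'd::finite, 'k::field) fmod rel \<Rightarrow> ('n, 'd, 'k) fmod set \<Rightarrow> ('n, 'd, 'k) fmod set \<Rightarrow>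
     ('n, 'd, 'k) fmod set"
  where "reduced_set r U V =
    {h \<in> V - {0}. lm r h \<in> mdvd_minimal (lead_mons r V) - lead_mons r U \<and> lc r h = 1 \<and>
      msupp (h - lm r h) \<inter> lead_mons r V = {}}"

text \<open>
  The leading monomials cancel in a difference, which therefore is an element of \<open>V\<close> supported
  outside the leading monomials of \<open>V\<close>, that is, \<open>0\<close>.
\<close>

lemma inj_on_lm_reduced_set:
  assumes r: "monomial_order r" and V: "fmod.subspace V"
  shows "inj_on (lm r) (reduced_set r U V)"
proof (rule inj_onI)
  fix g h assume g: "g \<in> reduced_set r U V" and h: "h \<in> reduced_set r U V" and eq: "lm r g = lm r h"
  have "msupp (g - h) \<subseteq> msupp (g - lm r g) \<union> msupp (h - lm r h)"
    using msupp_diff[of "g - lm r g" "h - lm r h"] eq by simp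
  then have "msupp (g - h) \<inter> lead_mons r V = {}"
    using g h by (auto simp: reduced_set_def)
  moreover have "g - h \<in> V"
    using g h V by (auto simp: reduced_set_def fmod.subspace_diff)
  ultimately show "g = h"
    using zero_if_msupp_disjoint_lead_mons[OF r] by fastforce
qed

text \<open>
  The preimage of a minimal monomial \<open>m\<close> is \<open>m\<close> minus a normal form of \<open>m\<close>.
\<close>

lemma lm_image_reduced_set:
  assumes r: "monomial_order r" and V: "fmod.subspace V"
  shows "lm r ` reduced_set r U V = mdvd_minimal (lead_mons r V) - lead_mons r U"
proof
  show "lm r ` reduced_set r U V \<subseteq> mdvd_minimal (lead_mons r V) - lead_mons r U"
    by (auto simp: reduced_set_def)
  show "mdvd_minimal (lead_mons r V) - lead_mons r U \<subseteq> lm r ` reduced_set r U V"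
  proof
    fix m assume m: "m \<in> mdvd_minimal (lead_mons r V) - lead_mons r U"
    then have mV: "m \<in> lead_mons r V" and mM: "m \<in> Mon"
      using lead_mons_subset_Mon[OF r] by (auto simp: mdvd_minimal_def)
    obtain g where g: "m - g \<in> V" "msupp g \<inter> lead_mons r V = {}"
      using normal_form_exists[OF r V] by blast
    have gm: "m \<notin> msupp g"
      using g(2) mV by auto
    then have coeff: "mcoeff (m - g) m = 1"
      using mM by (simp add: mcoeff_diff mcoeff_Mon msupp_def)
    then have nz: "m - g \<noteq> 0"
      using mM mcoeff_0[of m] by (metis zero_neq_one)
    have "lm r (m - g) \<in> msupp (m - g)"
      by (rule lm_in_msupp[OF r nz])
    then have "lm r (m - g) \<in> insert m (msupp g)"
      using msupp_diff[of m g] mM by (auto simp: msupp_Mon)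
    moreover have "lm r (m - g) \<in> lead_mons r V"
      using g(1) nz by (auto simp: lead_mons_def)
    ultimately have lm: "lm r (m - g) = m"
      using g(2) by auto
    \<comment> \<open>This bounds the tail of \<open>m - g\<close>, because \<open>m - g - m\<close> is \<open>0 - g\<close>.\<close>
    have "msupp (m - g - m) \<subseteq> msupp g"
      using msupp_diff[of 0 g] by (simp add: msupp_0)
    then have "m - g \<in> reduced_set r U V"
      using m g nz coeff lm by (auto simp: reduced_set_def lc_def)
    then show "m \<in> lm r ` reduced_set r U V"
      using lm by (metis imageI)
  qed
qed

theorem theoremA:
  fixes U V :: "('n::finite, 'd::finite, 'k::field) fmod set"
    and r :: "('n, 'd, 'k) fmod rel"
  assumes "fmod.subspace U" and "fmod.subspace V" and "U \<subseteq> V"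
    and "monomial_order r"
  shows "\<exists>!H. reduced_relative_GB r U V H"
proof -
  note U = assms(1) and V = assms(2) and UV = assms(3) and r = assms(4)
  note lead_mons_Mon = lead_mons_subset_Mon[OF r]
  have lead_mons_UV: "lead_mons r U \<subseteq> lead_mons r V"
    by (rule lead_mons_mono[OF UV])
  define R where "R = reduced_set r U V"
  define M where "M = mdvd_minimal (lead_mons r V) - lead_mons r U"
  have inj: "inj_on (lm r) R" and lm_R: "lm r ` R = M"
    unfolding R_def M_def using inj_on_lm_reduced_set lm_image_reduced_set r V by blast+
  have M_divisor: "\<exists>u\<in>M. mdvd u m" if "m \<in> lead_mons r V" "m \<notin> lead_mons r U" for m
    using mdvd_minimal_divisor[OF lead_mons_Mon that(1)] that(2) lead_mons_mdvd[OF r U] by (auto simp: M_def)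
  have "reduced_relative_GB r U V R"
    unfolding reduced_relative_GB_def minimal_relative_GB_def relative_GB_def Mon_diff_lm_module[OF r]
  proof (intro conjI ballI impI)
    have "finite M"
      using finite_mdvd_minimal[OF lead_mons_Mon] by (simp add: M_def)
    then show "finite R"
      using lm_R inj finite_image_iff by metis
    show "R \<subseteq> V - U"
      by (auto simp: R_def reduced_set_def lead_mons_def)
    have "mmultiples M \<union> lead_mons r U = lead_mons r V"
      using M_divisor lead_mons_mdvd[OF r V] lead_mons_UV
      by (auto simp: mmultiples_def M_def mdvd_minimal_def)
    then show "fmod.span (lm r ` R) + lm_module r U = lm_module r V"
      using span_lm_plus_lm_module_iff[OF r, of R] lm_R by (simp add: R_def reduced_set_def)
  next
    fix h assume h: "h \<in> R"
    have "h = lm r h + (h - lm r h)" by simp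
    then have "msupp h \<subseteq> insert (lm r h) (msupp (h - lm r h))"
      using msupp_add[of "lm r h" "h - lm r h"] h lm_in_Mon[OF r, of h]
      by (simp add: msupp_Mon R_def reduced_set_def)
    then show "msupp h \<subseteq> Mon - lead_mons r U"
      using h lead_mons_UV msupp_subset_Mon[of h] by (auto simp: R_def reduced_set_def)
    show "lc r h = 1" "msupp (h - lm r h) \<subseteq> Mon - lead_mons r V"
      using h msupp_subset_Mon by (auto simp: R_def reduced_set_def)
  next
    fix g h assume gh: "g \<in> R" "h \<in> R" "g \<noteq> h"
    then have "lm r g \<in> M" "lm r h \<in> M" "lm r g \<noteq> lm r h"
      using inj lm_R by (auto dest: inj_onD)
    then show "\<not> mdvd (lm r g) (lm r h)"
      by (auto simp: M_def mdvd_minimal_def)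
  qed
  moreover have "H = R" if H: "reduced_relative_GB r U V H" for H
  proof -
    have HV: "H \<subseteq> V - U"
      and anti: "\<And>g h. g \<in> H \<Longrightarrow> h \<in> H \<Longrightarrow> mdvd (lm r g) (lm r h) \<Longrightarrow> g = h"
      and suppU: "\<And>h. h \<in> H \<Longrightarrow> msupp h \<subseteq> Mon - lead_mons r U"
      and sum: "fmod.span (lm r ` H) + lm_module r U = lm_module r V"
      and red: "\<And>h. h \<in> H \<Longrightarrow> lc r h = 1 \<and> msupp (h - lm r h) \<subseteq> Mon - lead_mons r V"
      using H unfolding reduced_relative_GB_def minimal_relative_GB_def relative_GB_def
        Mon_diff_lm_module[OF r] by blast+
    have nz: "0 \<notin> H"
      using HV fmod.subspace_0[OF U] by auto
    have gen: "mmultiples (lm r ` H) \<union> lead_mons r U = lead_mons r V"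
      using sum span_lm_plus_lm_module_iff[OF r nz] by simp
    have lm_H: "lm r h \<in> lead_mons r V - lead_mons r U" if "h \<in> H" for h
    proof -
      have "h \<noteq> 0" using that nz by auto
      then show ?thesis
        using suppU[OF that] lm_in_msupp[OF r] HV that by (auto simp: lead_mons_def)
    qed
    \<comment> \<open>Within \<open>lead_mons r V\<close> only \<open>m\<close> itself divides \<open>m\<close>, so a generator dividing \<open>m\<close> equals it.\<close>
    have M_H: "M \<subseteq> lm r ` H"
    proof
      fix m assume m: "m \<in> M"
      then obtain h where h: "h \<in> H" "mdvd (lm r h) m"
        using gen by (auto simp: M_def mdvd_minimal_def mmultiples_def)
      then have "lm r h = m"
        using m lm_H by (auto simp: M_def mdvd_minimal_def)
      then show "m \<in> lm r ` H"
        using h(1) by auto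
    qed
    \<comment> \<open>Conversely the minimal divisor of \<open>lm r h\<close> is a leading monomial of the antichain, hence is
      \<open>lm r h\<close> itself.\<close>
    have H_M: "lm r h \<in> M" if h: "h \<in> H" for h
    proof -
      obtain u where u: "u \<in> M" "mdvd u (lm r h)"
        using M_divisor lm_H[OF h] by auto
      then obtain g where "g \<in> H" "u = lm r g"
        using M_H by auto
      then show ?thesis
        using anti[of g h] h u by auto
    qed
    have "H \<subseteq> R"
      using H_M HV nz red unfolding R_def reduced_set_def M_def by fastforce
    moreover have "lm r ` H = lm r ` R"
      using lm_R M_H H_M by auto
    ultimately show "H = R"
      using inj inj_on_image_eq_iff by blast
  qed
  ultimately show ?thesis
    by blast
qed

end
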